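(* For any even $n\ge 6$ and any edge $e\in E(V_n)$, the inequality $x_e\le 1$ is facet-defining for $\textsc{Bond}(V_n)$.
   Context: For even $n$, the (generalized) Wagner graph $V_n$ is obtained from the cycle $C_n$ on vertices $1,\dots,n$ (in cyclic order) by adding the edges $\{i,i+\tfrac n2\}$ for $1\le i\le\tfrac n2$. For a graph $G=(V,E)$ and $S\subseteq V$, the cut $\delta(S)=\{e\in E:|e\cap S|=1\}$ is a bond if $G[S]$ and $G[V\setminus S]$ are connected. $x^\delta$ is the incidence vector, $\textsc{Bond}(G)=\mathrm{conv}\{x^\delta:\delta\text{ a bond}\}$. *)

theory Defs
  imports "HOL-Analysis.Analysis"
begin

definition wagner_verts :: "nat \<Rightarrow> nat set" where
  "wagner_verts n = {1..n}"

definition wagner_edges :: "nat \<Rightarrow> nat set set" where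
  "wagner_edges n =
     {{i, i + 1} | i. 1 \<le> i \<and> i < n} \<union> {{n, 1}}
     \<union> {{i, i + n div 2} | i. 1 \<le> i \<and> i \<le> n div 2}"

text \<open>A graph is given by its vertex set \<open>V\<close> and its edge set \<open>E\<close>, a set of two-element subsets
  of \<open>V\<close>. The graph without vertices counts as connected.\<close>

definition graph_connected :: "'v set \<Rightarrow> 'v set set \<Rightarrow> bool" where
  "graph_connected V E \<longleftrightarrow>
     (\<forall>u\<in>V. \<forall>v\<in>V. (u, v) \<in> {(x, y). x \<in> V \<and> y \<in> V \<and> {x, y} \<in> E}\<^sup>*)"

definition induced_edges :: "'v set set \<Rightarrow> 'v set \<Rightarrow> 'v set set" where
  "induced_edges E S = {e \<in> E. e \<subseteq> S}"

definition cut :: "'v set set \<Rightarrow> 'v set \<Rightarrow> 'v set set" where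
  "cut E S = {e \<in> E. card (e \<inter> S) = 1}"

text \<open>\<open>S = {}\<close> and \<open>S = V\<close> are not excluded, so the empty cut of a connected graph is a bond.\<close>

definition bonds :: "'v set \<Rightarrow> 'v set set \<Rightarrow> 'v set set set" where
  "bonds V E =
     {cut E S | S. S \<subseteq> V \<and> graph_connected S (induced_edges E S)
                        \<and> graph_connected (V - S) (induced_edges E (V - S))}"

text \<open>The space of real vectors indexed by \<open>E\<close> is rendered as \<open>real ^ 'e\<close>, where \<open>'e\<close> is a finite
  type and \<open>edge\<close> is a bijection from \<open>'e\<close> onto \<open>E\<close>; coordinate \<open>i\<close> belongs to the edge \<open>edge i\<close>.\<close>

definition incidence_vec :: "('e::finite \<Rightarrow> 'v set) \<Rightarrow> 'v set set \<Rightarrow> real ^ 'e" where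
  "incidence_vec edge D = (\<chi> i. if edge i \<in> D then 1 else 0)"

definition bond_polytope ::
    "'v set \<Rightarrow> 'v set set \<Rightarrow> ('e::finite \<Rightarrow> 'v set) \<Rightarrow> (real ^ 'e) set" where
  "bond_polytope V E edge = convex hull (incidence_vec edge ` bonds V E)"

definition facet_defining :: "'a::euclidean_space \<Rightarrow> real \<Rightarrow> 'a set \<Rightarrow> bool" where
  "facet_defining a b P \<longleftrightarrow>
     (\<forall>x\<in>P. a \<bullet> x \<le> b) \<and> (P \<inter> {x. a \<bullet> x = b}) facet_of P"

end

theory Submission
  imports Defs
begin

text \<open>Since the empty cut is a bond, the face \<open>x\<^sub>e = 1\<close> is proper, so it suffices that its affine hull is
  the whole hyperplane \<open>x\<^sub>e = 1\<close>. Dually, let \<open>w\<close> be edge weights taking the same total on all bonds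
  through \<open>e\<close>; one has to see that \<open>w\<close> vanishes off \<open>e\<close>. If \<open>S\<close> and \<open>S \<union> {v}\<close> both induce bonds
  through \<open>e\<close>, comparing them gives a signed relation between the weights of the three edges at \<open>v\<close>.
  Letting \<open>S\<close> run over arcs of the rim, arcs together with one vertex opposite to an end, and
  a few short pieces of the ladder, these relations and their images under the symmetries
  fixing \<open>e\<close> force all weights other than \<open>w e\<close> to be zero.\<close>

section \<open>Connected unions, and bonds described by a side\<close>

lemma graph_connected_singleton: "graph_connected {v} E"
  by (simp add: graph_connected_def)

lemma graph_connected_induced_Un:
  assumes A: "graph_connected A (induced_edges E A)"
    and B: "graph_connected B (induced_edges E B)"
    and ab: "a \<in> A" "b \<in> B" "{a, b} \<in> E"
  shows "graph_connected (A \<union> B) (induced_edges E (A \<union> B))"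
proof -
  define R where "R S = {(x, y). x \<in> S \<and> y \<in> S \<and> {x, y} \<in> induced_edges E S}" for S
  have mono: "(R A)\<^sup>* \<subseteq> (R (A \<union> B))\<^sup>*" "(R B)\<^sup>* \<subseteq> (R (A \<union> B))\<^sup>*"
    by (rule rtrancl_mono; auto simp: R_def induced_edges_def)+
  have inA: "(u, v) \<in> (R (A \<union> B))\<^sup>*" if "u \<in> A" "v \<in> A" for u v
    using A that mono(1) unfolding graph_connected_def R_def by blast
  have inB: "(u, v) \<in> (R (A \<union> B))\<^sup>*" if "u \<in> B" "v \<in> B" for u v
    using B that mono(2) unfolding graph_connected_def R_def by blast
  have edge: "(a, b) \<in> (R (A \<union> B))\<^sup>*" "(b, a) \<in> (R (A \<union> B))\<^sup>*"
    using ab by (auto simp: R_def induced_edges_def insert_commute intro: r_into_rtrancl)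
  have "(u, v) \<in> (R (A \<union> B))\<^sup>*" if "u \<in> A \<union> B" "v \<in> A \<union> B" for u v
  proof -
    have "(u, a) \<in> (R (A \<union> B))\<^sup>*"
      using that(1) inA[OF _ ab(1)] rtrancl_trans[OF inB[OF _ ab(2)] edge(2)] by blast
    moreover have "(a, v) \<in> (R (A \<union> B))\<^sup>*"
      using that(2) inA[OF ab(1)] rtrancl_trans[OF edge(1) inB[OF ab(2)]] by blast
    ultimately show ?thesis by (rule rtrancl_trans)
  qed
  then show ?thesis
    unfolding graph_connected_def R_def by blast
qed

text \<open>The vertex set is kept as an argument because the proof compares sides that differ by
  one vertex; \<open>bonds\<close> retains only the edge sets.\<close>

definition bond_side :: "'v set \<Rightarrow> 'v set set \<Rightarrow> 'v set \<Rightarrow> bool" where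
  "bond_side V E S \<longleftrightarrow> S \<subseteq> V \<and> graph_connected S (induced_edges E S)
     \<and> graph_connected (V - S) (induced_edges E (V - S))"

lemma bonds_eq_cut_bond_side: "bonds V E = cut E ` Collect (bond_side V E)"
  by (auto simp: bonds_def bond_side_def)

lemma mem_cut_pair:
  assumes "a \<noteq> b"
  shows "{a, b} \<in> cut E S \<longleftrightarrow> {a, b} \<in> E \<and> (a \<in> S \<longleftrightarrow> b \<notin> S)"
  using assms by (cases "a \<in> S"; cases "b \<in> S") (auto simp: cut_def Int_insert_left)

text \<open>Equivalently, the functional \<open>w\<close> is constant on the face \<open>x\<^sub>e = 1\<close> of the bond polytope.\<close>

definition balanced_at :: "'v set \<Rightarrow> 'v set set \<Rightarrow> 'v set \<Rightarrow> ('v set \<Rightarrow> real) \<Rightarrow> bool" where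
  "balanced_at V E e w \<longleftrightarrow> (\<exists>d. \<forall>D\<in>bonds V E. e \<in> D \<longrightarrow> sum w D = d)"

text \<open>The vertices are labelled by integers modulo \<open>2 * k\<close>, so that rotations and reflections are
  mere relabellings.\<close>

locale moebius_ladder =
  fixes k :: int and \<psi> :: "int \<Rightarrow> 'v" and V :: "'v set" and E :: "'v set set"
  assumes k: "k \<ge> 3"
    and \<psi>_eq_iff: "\<psi> i = \<psi> j \<longleftrightarrow> 2 * k dvd i - j"
    and V: "V = range \<psi>"
    and E: "E = range (\<lambda>i. {\<psi> i, \<psi> (i + 1)}) \<union> range (\<lambda>i. {\<psi> i, \<psi> (i + k)})"
begin

section \<open>Rim edges and rungs; rotations and reflections of the ladder\<close>

definition "rim i = {\<psi> i, \<psi> (i + 1)}"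
definition "rung i = {\<psi> i, \<psi> (i + k)}"

lemma E_eq: "E = range rim \<union> range rung"
  unfolding E rim_def rung_def ..

lemma rim_in_E: "rim i \<in> E" and rung_in_E: "rung i \<in> E"
  by (auto simp: E_eq)

text \<open>Interpreting the locale with the shifted labelling carries every later weight relation
  to the rotated position.\<close>

lemma rotate: "moebius_ladder k (\<lambda>i. \<psi> (i + s)) V E"
proof
  show "V = range (\<lambda>i. \<psi> (i + s))"
    unfolding V by (auto simp: image_def) (metis diff_add_cancel)
  have "range (\<lambda>i. {\<psi> (i + s), \<psi> (i + s + t)}) = range (\<lambda>i. {\<psi> i, \<psi> (i + t)})" for t
    by (auto simp: image_def) (metis diff_add_cancel)
  from this[of 1] this[of k]
  show "E = range (\<lambda>i. {\<psi> (i + s), \<psi> (i + 1 + s)}) \<union> range (\<lambda>i. {\<psi> (i + s), \<psi> (i + k + s)})"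
    unfolding E by (simp add: algebra_simps)
qed (use k \<psi>_eq_iff in auto)

text \<open>Reversal turns the edge with ends \<open>i\<close> and \<open>i + t\<close> into the one
  based at \<open>s - i - t\<close>, so rim edges remain rim edges and rungs remain rungs.\<close>

lemma reflect: "moebius_ladder k (\<lambda>i. \<psi> (s - i)) V E"
proof
  show "\<psi> (s - i) = \<psi> (s - j) \<longleftrightarrow> 2 * k dvd i - j" for i j
    using \<psi>_eq_iff[of "s - j" "s - i"] by (auto simp: eq_commute)
  show "V = range (\<lambda>i. \<psi> (s - i))"
    unfolding V by (auto simp: image_def) (metis diff_diff_eq2 add_diff_cancel_left')
  have "range (\<lambda>i. {\<psi> (s - i), \<psi> (s - (i + t))}) = range (\<lambda>i. {\<psi> i, \<psi> (i + t)})" for t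
  proof (intro equalityI subsetI)
    fix f assume "f \<in> range (\<lambda>i. {\<psi> (s - i), \<psi> (s - (i + t))})"
    then obtain i where "f = {\<psi> (s - i), \<psi> (s - (i + t))}" by auto
    then have "f = {\<psi> (s - i - t), \<psi> (s - i - t + t)}" by (auto simp: algebra_simps)
    then show "f \<in> range (\<lambda>i. {\<psi> i, \<psi> (i + t)})" by blast
  next
    fix f assume "f \<in> range (\<lambda>i. {\<psi> i, \<psi> (i + t)})"
    then obtain i where "f = {\<psi> i, \<psi> (i + t)}" by auto
    then have "f = {\<psi> (s - (s - i - t)), \<psi> (s - ((s - i - t) + t))}" by (auto simp: algebra_simps)
    then show "f \<in> range (\<lambda>i. {\<psi> (s - i), \<psi> (s - (i + t))})" by blast
  qed
  from this[of 1] this[of k]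
  show "E = range (\<lambda>i. {\<psi> (s - i), \<psi> (s - (i + 1))}) \<union> range (\<lambda>i. {\<psi> (s - i), \<psi> (s - (i + k))})"
    unfolding E by simp
qed (use k in auto)

section \<open>Labels modulo \<open>2 * k\<close> and representatives of edges\<close>

lemma \<psi>_periodic: "\<psi> (i + 2 * k) = \<psi> i"
  by (simp add: \<psi>_eq_iff)

lemma \<psi>_near_neq:
  assumes "i \<noteq> j" "\<bar>i - j\<bar> < 2 * k"
  shows "\<psi> i \<noteq> \<psi> j"
  using assms dvd_imp_le_int[of "i - j" "2 * k"] k by (auto simp: \<psi>_eq_iff)

lemma inj_on_\<psi>: "inj_on \<psi> {1..2 * k}"
  using \<psi>_near_neq by (force intro!: inj_onI)

lemma ex_\<psi>_in_period: "\<exists>j\<in>{1..2 * k}. 2 * k dvd i - j"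
proof
  have "i - ((i - 1) mod (2 * k) + 1) = (i - 1) - (i - 1) mod (2 * k)" by simp
  then show "2 * k dvd i - ((i - 1) mod (2 * k) + 1)" by (metis dvd_minus_mod)
  show "(i - 1) mod (2 * k) + 1 \<in> {1..2 * k}"
    using k pos_mod_bound[of "2 * k" "i - 1"] pos_mod_sign[of "2 * k" "i - 1"]
    unfolding atLeastAtMost_iff by linarith
qed

lemma V_eq: "V = \<psi> ` {1..2 * k}"
proof -
  have "\<psi> i \<in> \<psi> ` {1..2 * k}" for i
    using ex_\<psi>_in_period[of i] \<psi>_eq_iff by blast
  then show ?thesis unfolding V by auto
qed

lemma \<psi>_mem_image_iff:
  assumes "A \<subseteq> {1..2 * k}" "i \<in> {1..2 * k}"
  shows "\<psi> i \<in> \<psi> ` A \<longleftrightarrow> i \<in> A"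
  using inj_on_image_mem_iff[OF inj_on_\<psi> assms(2,1)] .

lemma rim_cong: "2 * k dvd i - j \<Longrightarrow> rim i = rim j"
  unfolding rim_def using \<psi>_eq_iff[of i j] \<psi>_eq_iff[of "i + 1" "j + 1"] by simp

lemma rung_cong: "2 * k dvd i - j \<Longrightarrow> rung i = rung j"
  unfolding rung_def using \<psi>_eq_iff[of i j] \<psi>_eq_iff[of "i + k" "j + k"] by simp

lemma rung_shift: "rung (i + k) = rung i"
  using \<psi>_periodic[of i] by (auto simp: rung_def algebra_simps)

lemma rim_cases: obtains j where "j \<in> {1..2 * k}" "rim i = rim j"
  using ex_\<psi>_in_period[of i] rim_cong by blast

text \<open>Every rung carries two labels that differ by \<open>k\<close>, one for each end, so half
  a period suffices.\<close>

lemma rung_cases: obtains j where "j \<in> {1..k}" "rung i = rung j"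
proof -
  obtain j where j: "j \<in> {1..2 * k}" "rung i = rung j"
    using ex_\<psi>_in_period[of i] rung_cong by blast
  show thesis
  proof (cases "j \<le> k")
    case True
    with j that show ?thesis by auto
  next
    case False
    have "rung j = rung (j - k)" using rung_shift[of "j - k"] by simp
    with j that[of "j - k"] False show ?thesis by auto
  qed
qed

lemma finite_E: "finite E"
proof -
  have "E \<subseteq> Pow V" unfolding E V by auto
  moreover have "finite V" unfolding V_eq by simp
  ultimately show ?thesis using finite_subset by blast
qed

section \<open>Arcs of the rim, pairs of arcs, and the bonds they give\<close>

lemma interval_connected: "graph_connected (\<psi> ` {a..b}) (induced_edges E (\<psi> ` {a..b}))"
proof (cases "a \<le> b")
  case True
  then show ?thesis
  proof (induction b rule: int_ge_induct)
    case base
    show ?case by (simp add: graph_connected_singleton)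
  next
    case (step b)
    have "{a..b + 1} = {a..b} \<union> {b + 1}" using step.hyps by auto
    then have eq: "\<psi> ` {a..b + 1} = \<psi> ` {a..b} \<union> {\<psi> (b + 1)}" by simp
    show ?case
      unfolding eq
      by (rule graph_connected_induced_Un[OF step.IH graph_connected_singleton, of "\<psi> b"])
        (use step.hyps rim_in_E[of b] in \<open>auto simp: rim_def\<close>)
  qed
next
  case False
  then show ?thesis by (simp add: graph_connected_def)
qed

lemma two_intervals_connected:
  assumes "i \<in> {a..b}" "i + k \<in> {c..d}"
  shows "graph_connected (\<psi> ` ({a..b} \<union> {c..d})) (induced_edges E (\<psi> ` ({a..b} \<union> {c..d})))"
  unfolding image_Un
  by (rule graph_connected_induced_Un[OF interval_connected interval_connected,
        of "\<psi> i" _ _ "\<psi> (i + k)"])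
    (use assms rung_in_E[of i] in \<open>auto simp: rung_def\<close>)

lemma V_Diff_image:
  assumes "A \<subseteq> {1..2 * k}"
  shows "V - \<psi> ` A = \<psi> ` ({1..2 * k} - A)"
  unfolding V_eq using inj_on_image_set_diff[OF inj_on_\<psi> Diff_subset assms] by simp

text \<open>The complement of an arc is again an arc. For \<open>j \<le> 0\<close> the side is
  empty, which later yields the empty bond.\<close>

lemma bond_side_interval:
  assumes "j \<le> 2 * k"
  shows "bond_side V E (\<psi> ` {1..j})"
proof -
  have sub: "{1..j} \<subseteq> {1..2 * k}" using assms by auto
  have "{1..2 * k} - {1..j} = {max 1 (j + 1)..2 * k}" using assms by auto
  then show ?thesis
    unfolding bond_side_def V_Diff_image[OF sub]
    using interval_connected sub by (auto simp: V)
qed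

text \<open>The rung at \<open>m\<close> joins the two arcs. The complement also consists of two
  arcs, one containing \<open>k\<close> and the other \<open>2 * k\<close>, so the rung at
  \<open>k\<close> joins them.\<close>

lemma bond_side_two_intervals:
  assumes "1 \<le> m" "m \<le> j" "m \<le> l" "j < k" "l < k"
  shows "bond_side V E (\<psi> ` ({1..j} \<union> {k + m..k + l}))"
proof -
  have sub: "{1..j} \<union> {k + m..k + l} \<subseteq> {1..2 * k}" using assms by auto
  have eq: "{1..2 * k} - ({1..j} \<union> {k + m..k + l}) = {j + 1..k + m - 1} \<union> {k + l + 1..2 * k}"
    using assms by auto
  have "graph_connected (V - \<psi> ` ({1..j} \<union> {k + m..k + l}))
      (induced_edges E (V - \<psi> ` ({1..j} \<union> {k + m..k + l})))"
    unfolding V_Diff_image[OF sub] eq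
    by (rule two_intervals_connected[of k]) (use assms in auto)
  moreover have "graph_connected (\<psi> ` ({1..j} \<union> {k + m..k + l}))
      (induced_edges E (\<psi> ` ({1..j} \<union> {k + m..k + l})))"
    by (rule two_intervals_connected[of m]) (use assms in auto)
  ultimately show ?thesis
    unfolding bond_side_def by (auto simp: V)
qed

section \<open>Weight relations obtained by moving one vertex across a cut\<close>

text \<open>Only the three edges at \<open>\<psi> i\<close> change status: an edge to a neighbour
  inside \<open>S\<close> leaves the cut, an edge to a neighbour outside enters it.\<close>

lemma sum_cut_insert:
  fixes w :: "'v set \<Rightarrow> real"
  assumes "\<psi> i \<notin> S"
  shows "sum w (cut E (insert (\<psi> i) S)) = sum w (cut E S)
    + (if \<psi> (i - 1) \<in> S then - w (rim (i - 1)) else w (rim (i - 1)))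
    + (if \<psi> (i + 1) \<in> S then - w (rim i) else w (rim i))
    + (if \<psi> (i + k) \<in> S then - w (rung i) else w (rung i))"
proof -
  define N where "N = {rim (i - 1), rim i, rung i}"
  \<comment> \<open>The vertex and its three neighbours are pairwise distinct; hence the three edges
    are distinct and the sum over \<open>N\<close> splits into three terms.\<close>
  have neq: "\<psi> (i - 1) \<noteq> \<psi> i" "\<psi> i \<noteq> \<psi> (i + 1)" "\<psi> i \<noteq> \<psi> (i + k)" "\<psi> (i - 1) \<noteq> \<psi> (i + 1)"
    "\<psi> (i - 1) \<noteq> \<psi> (i + k)" "\<psi> (i + 1) \<noteq> \<psi> (i + k)"
    by (rule \<psi>_near_neq; use k in simp)+
  have distinct: "rim (i - 1) \<noteq> rim i" "rim (i - 1) \<noteq> rung i" "rim i \<noteq> rung i"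
    using neq unfolding rim_def rung_def diff_add_cancel doubleton_eq_iff by metis+
  have sum_eq: "sum w (cut E T) = (\<Sum>f\<in>E - N. if f \<in> cut E T then w f else 0)
      + (if rim (i - 1) \<in> cut E T then w (rim (i - 1)) else 0)
      + (if rim i \<in> cut E T then w (rim i) else 0)
      + (if rung i \<in> cut E T then w (rung i) else 0)" for T
  proof -
    have "sum w (cut E T) = (\<Sum>f\<in>E. if f \<in> cut E T then w f else 0)"
      using finite_E unfolding cut_def by (simp add: sum.inter_filter)
    also have "\<dots> = (\<Sum>f\<in>E - N. if f \<in> cut E T then w f else 0)
        + (\<Sum>f\<in>N. if f \<in> cut E T then w f else 0)"
      by (rule sum.subset_diff) (auto simp: N_def finite_E rim_in_E rung_in_E)
    finally show ?thesis using distinct by (simp add: N_def)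
  qed
  \<comment> \<open>No edge outside \<open>N\<close> meets \<open>\<psi> i\<close>, so its
    intersection with the side is unchanged.\<close>
  have rest: "f \<in> cut E (insert (\<psi> i) S) \<longleftrightarrow> f \<in> cut E S" if f: "f \<in> E - N" for f
  proof -
    have "\<psi> i \<notin> f"
    proof
      assume in_f: "\<psi> i \<in> f"
      from f consider j where "f = rim j" | j where "f = rung j" unfolding E_eq by blast
      then show False
      proof cases
        case 1
        with in_f consider "\<psi> i = \<psi> j" | "\<psi> i = \<psi> (j + 1)" by (auto simp: rim_def)
        then have "f = rim i \<or> f = rim (i - 1)"
        proof cases
          case 1
          then show ?thesis using \<open>f = rim j\<close> rim_cong[of i j] \<psi>_eq_iff by auto
        next
          case 2
          then show ?thesis using \<open>f = rim j\<close> rim_cong[of "i - 1" j] \<psi>_eq_iff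
            by (auto simp: algebra_simps)
        qed
        with f show False by (auto simp: N_def)
      next
        case 2
        with in_f consider "\<psi> i = \<psi> j" | "\<psi> i = \<psi> (j + k)" by (auto simp: rung_def)
        then have "f = rung i"
        proof cases
          case 1
          then show ?thesis using \<open>f = rung j\<close> rung_cong[of i j] \<psi>_eq_iff by auto
        next
          case 2
          then show ?thesis using \<open>f = rung j\<close> rung_cong[of i "j + k"] rung_shift[of j] \<psi>_eq_iff
            by auto
        qed
        with f show False by (auto simp: N_def)
      qed
    qed
    then have "f \<inter> insert (\<psi> i) S = f \<inter> S" by auto
    then show ?thesis by (simp add: cut_def)
  qed
  have "(\<Sum>f\<in>E - N. if f \<in> cut E (insert (\<psi> i) S) then w f else 0)
      = (\<Sum>f\<in>E - N. if f \<in> cut E S then w f else 0)"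
    by (rule sum.cong) (use rest in auto)
  moreover have
    "rim (i - 1) \<in> cut E T \<longleftrightarrow> (\<psi> (i - 1) \<in> T \<longleftrightarrow> \<psi> i \<notin> T)"
    "rim i \<in> cut E T \<longleftrightarrow> (\<psi> i \<in> T \<longleftrightarrow> \<psi> (i + 1) \<notin> T)"
    "rung i \<in> cut E T \<longleftrightarrow> (\<psi> i \<in> T \<longleftrightarrow> \<psi> (i + k) \<notin> T)" for T
    using mem_cut_pair[OF neq(1), of E T] mem_cut_pair[OF neq(2), of E T]
      mem_cut_pair[OF neq(3), of E T] rim_in_E[of "i - 1"] rim_in_E[of i] rung_in_E[of i]
    by (auto simp: rim_def rung_def)
  ultimately show ?thesis
    unfolding sum_eq[of "insert (\<psi> i) S"] sum_eq[of S] using assms neq by simp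
qed

text \<open>Both sides contain \<open>p\<close> and miss \<open>q\<close>, so both bonds pass
  through the balanced edge and have the same total weight; the difference computed in
  \<open>sum_cut_insert\<close> is therefore zero.\<close>

lemma balanced_at_move:
  fixes w :: "'v set \<Rightarrow> real"
  assumes bal: "balanced_at V E {\<psi> p, \<psi> q} w" and e: "{\<psi> p, \<psi> q} \<in> E"
    and A: "insert i A \<subseteq> {1..2 * k}" "i \<notin> A"
    and sides: "bond_side V E (\<psi> ` A)" "bond_side V E (\<psi> ` insert i A)"
    and pq: "p \<in> A" "q \<in> {1..2 * k}" "q \<notin> insert i A"
  shows "(if \<psi> (i - 1) \<in> \<psi> ` A then - w (rim (i - 1)) else w (rim (i - 1)))
    + (if \<psi> (i + 1) \<in> \<psi> ` A then - w (rim i) else w (rim i))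
    + (if \<psi> (i + k) \<in> \<psi> ` A then - w (rung i) else w (rung i)) = 0"
proof -
  have q: "\<psi> q \<notin> \<psi> ` insert i A"
    using \<psi>_mem_image_iff[OF A(1) pq(2)] pq(3) by simp
  have p: "\<psi> p \<in> \<psi> ` A" using pq(1) by simp
  have neq: "\<psi> p \<noteq> \<psi> q" using p q by auto
  have i: "\<psi> i \<notin> \<psi> ` A" using \<psi>_mem_image_iff[of A i] A by auto
  obtain d where d: "\<And>D. D \<in> bonds V E \<Longrightarrow> {\<psi> p, \<psi> q} \<in> D \<Longrightarrow> sum w D = d"
    using bal by (auto simp: balanced_at_def)
  have "sum w (cut E (\<psi> ` A)) = d"
    using sides p q e by (intro d) (auto simp: bonds_eq_cut_bond_side mem_cut_pair[OF neq])
  moreover have "sum w (cut E (insert (\<psi> i) (\<psi> ` A))) = d"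
    using sides p q e by (intro d) (auto simp: bonds_eq_cut_bond_side mem_cut_pair[OF neq])
  ultimately show ?thesis using sum_cut_insert[OF i, of w] by simp
qed

text \<open>The arc \<open>{1..b}\<close> grows by \<open>b + 1\<close>: \<open>rim b\<close> leaves
  the cut, while the next rim edge and the rung at the new vertex enter.\<close>

lemma balanced_at_extend_interval:
  assumes bal: "balanced_at V E {\<psi> 1, \<psi> q} w" and e: "{\<psi> 1, \<psi> q} \<in> E"
    and q: "q \<in> {k + 1..2 * k}" and b: "1 \<le> b" "b < k"
  shows "w (rim b) = w (rim (b + 1)) + w (rung (b + 1))"
proof -
  have ins: "insert (b + 1) {1..b} = {1..b + 1}" using b by auto
  have mem: "\<psi> j \<in> \<psi> ` {1..b} \<longleftrightarrow> j \<in> {1..b}" if "j \<in> {1..2 * k}" for j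
    by (rule \<psi>_mem_image_iff) (use that b in auto)
  have "(if \<psi> (b + 1 - 1) \<in> \<psi> ` {1..b} then - w (rim (b + 1 - 1)) else w (rim (b + 1 - 1)))
    + (if \<psi> (b + 1 + 1) \<in> \<psi> ` {1..b} then - w (rim (b + 1)) else w (rim (b + 1)))
    + (if \<psi> (b + 1 + k) \<in> \<psi> ` {1..b} then - w (rung (b + 1)) else w (rung (b + 1))) = 0"
    by (rule balanced_at_move[OF bal e]; (unfold ins)?)
      (use b q in \<open>auto intro!: bond_side_interval\<close>)
  then show ?thesis
    using b by (simp add: mem)
qed

text \<open>The arc \<open>{1..j}\<close> is joined by the vertex opposite to its end
  \<open>j\<close>: the rung leaves the cut and both rim edges at \<open>k + j\<close> enter. The
  vertex added must not be \<open>q\<close>.\<close>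

lemma balanced_at_add_opposite:
  assumes bal: "balanced_at V E {\<psi> 1, \<psi> q} w" and e: "{\<psi> 1, \<psi> q} \<in> E"
    and q: "q \<in> {k + 1..2 * k}" "q \<noteq> k + j" and j: "1 \<le> j" "j < k"
  shows "w (rim (k + j - 1)) + w (rim (k + j)) = w (rung j)"
proof -
  have ins: "insert (k + j) {1..j} = {1..j} \<union> {k + j..k + j}" by auto
  have mem: "\<psi> i \<in> \<psi> ` {1..j} \<longleftrightarrow> i \<in> {1..j}" if "i \<in> {1..2 * k}" for i
    by (rule \<psi>_mem_image_iff) (use that j in auto)
  have sides: "bond_side V E (\<psi> ` {1..j})" "bond_side V E (\<psi> ` insert (k + j) {1..j})"
    unfolding ins by (rule bond_side_interval bond_side_two_intervals; use j in simp)+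
  have "(if \<psi> (k + j - 1) \<in> \<psi> ` {1..j} then - w (rim (k + j - 1)) else w (rim (k + j - 1)))
    + (if \<psi> (k + j + 1) \<in> \<psi> ` {1..j} then - w (rim (k + j)) else w (rim (k + j)))
    + (if \<psi> (k + j + k) \<in> \<psi> ` {1..j} then - w (rung (k + j)) else w (rung (k + j))) = 0"
    by (rule balanced_at_move[OF bal e _ _ sides]) (use j q in auto)
  moreover have "\<psi> (k + j + k) = \<psi> j" using \<psi>_periodic[of j] by (simp add: algebra_simps)
  moreover have "rung (k + j) = rung j" using rung_shift[of j] by (simp add: add.commute)
  ultimately show ?thesis
    using j by (simp add: mem)
qed

text \<open>Vertex \<open>2\<close> completes the square on \<open>1\<close>, \<open>2\<close>,
  \<open>k + 1\<close>, \<open>k + 2\<close>. Compared with extending \<open>{1..1}\<close>, the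
  rung at \<open>2\<close> now leaves the cut instead of entering, so its sign is reversed.\<close>

lemma balanced_at_add_corner:
  assumes bal: "balanced_at V E {\<psi> 1, \<psi> (2 * k)} w" and e: "{\<psi> 1, \<psi> (2 * k)} \<in> E"
  shows "w (rim 2) = w (rim 1) + w (rung 2)"
proof -
  define A where "A = {1..1} \<union> {k + 1..k + 2}"
  have ins: "insert 2 A = {1..2} \<union> {k + 1..k + 2}" by (auto simp: A_def)
  have sub: "A \<subseteq> {1..2 * k}" using k by (auto simp: A_def)
  have mem: "\<psi> i \<in> \<psi> ` A \<longleftrightarrow> i \<in> A" if "i \<in> {1..2 * k}" for i
    by (rule \<psi>_mem_image_iff) (use that sub in auto)
  have sides: "bond_side V E (\<psi> ` A)" "bond_side V E (\<psi> ` insert 2 A)"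
    unfolding ins unfolding A_def by (rule bond_side_two_intervals; use k in simp)+
  have "(if \<psi> (2 - 1) \<in> \<psi> ` A then - w (rim (2 - 1)) else w (rim (2 - 1)))
    + (if \<psi> (2 + 1) \<in> \<psi> ` A then - w (rim 2) else w (rim 2))
    + (if \<psi> (2 + k) \<in> \<psi> ` A then - w (rung 2) else w (rung 2)) = 0"
    by (rule balanced_at_move[OF bal e _ _ sides]) (use k in \<open>auto simp: A_def\<close>)
  then show ?thesis
    using k by (simp add: mem) (simp add: A_def)
qed

section \<open>Weights balanced at a rung\<close>

lemma balanced_at_rung_rims:
  assumes bal: "balanced_at V E (rung 1) w"
  shows "j \<in> {1..k} \<Longrightarrow> w (rim j) = 0" and "j \<in> {2..k} \<Longrightarrow> w (rung j) = 0"
proof -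
  \<comment> \<open>Both symmetries exchange \<open>1\<close> and \<open>k + 1\<close>, hence fix
    \<open>rung 1\<close>; the rotation by \<open>k\<close> fixes every rung.\<close>
  interpret R: moebius_ladder k "\<lambda>i. \<psi> (k + 2 - i)" V E by (rule reflect)
  interpret T: moebius_ladder k "\<lambda>i. \<psi> (i + k)" V E by (rule rotate)
  have R_rim: "R.rim i = rim (k + 1 - i)" for i
    by (auto simp: R.rim_def rim_def algebra_simps)
  have R_rung: "R.rung i = rung (2 - i)" for i
    by (auto simp: R.rung_def rung_def algebra_simps)
  have T_rim: "T.rim i = rim (i + k)" for i
    by (auto simp: T.rim_def rim_def algebra_simps)
  have T_rung: "T.rung i = rung i" for i
    using rung_shift[of i] by (auto simp: T.rung_def rung_def algebra_simps)
  have e: "{\<psi> 1, \<psi> (k + 1)} = rung 1" by (simp add: rung_def add.commute)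
  have eR: "{\<psi> (k + 2 - 1), \<psi> (k + 2 - (k + 1))} = rung 1" by (auto simp: rung_def algebra_simps)
  have eT: "{\<psi> (1 + k), \<psi> (k + 1 + k)} = rung 1"
    using rung_shift[of 1] by (simp add: rung_def algebra_simps)
  \<comment> \<open>The extension relation and its mirror image are the same equation with
    \<open>rim b\<close> and \<open>rim (b + 1)\<close> exchanged; adding them kills the
    rung.\<close>
  have step: "w (rim b) = w (rim (b + 1)) \<and> w (rung (b + 1)) = 0" if b: "1 \<le> b" "b < k" for b
  proof -
    have "w (rim b) = w (rim (b + 1)) + w (rung (b + 1))"
      by (rule balanced_at_extend_interval[of "k + 1"])
        (use bal e rung_in_E b k in auto)
    moreover have "w (R.rim (k - b)) = w (R.rim (k - b + 1)) + w (R.rung (k - b + 1))"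
      by (rule R.balanced_at_extend_interval[of "k + 1"], unfold eR)
        (use bal rung_in_E b k in auto)
    moreover have "rung (1 - k + b) = rung (b + 1)"
      using rung_shift[of "1 - k + b"] by (simp add: add.commute)
    ultimately show ?thesis by (simp add: R_rim R_rung algebra_simps)
  qed
  have const: "1 \<le> j \<Longrightarrow> j \<le> k \<longrightarrow> w (rim j) = w (rim 1)" for j
    by (induction j rule: int_ge_induct) (use step in auto)
  \<comment> \<open>The rims \<open>1\<close> to \<open>k\<close> have a common weight, and this
    relation makes twice that weight zero. The choice is \<open>j = 2\<close> because
    \<open>j = 1\<close> would add the other end of \<open>rung 1\<close>.\<close>
  have "w (T.rim (k + 2 - 1)) + w (T.rim (k + 2)) = w (T.rung 2)"
    by (rule T.balanced_at_add_opposite[of "k + 1"], unfold eT)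
      (use bal rung_in_E k in auto)
  moreover have "rim (k + 2 - 1 + k) = rim 1" "rim (k + 2 + k) = rim 2"
    by (rule rim_cong; simp)+
  ultimately have "w (rim 1) + w (rim 2) = 0"
    using step[of 1] k by (simp add: T_rim T_rung)
  then have "w (rim 1) = 0" using step[of 1] k by simp
  then show "j \<in> {1..k} \<Longrightarrow> w (rim j) = 0" using const[of j] by simp
  show "j \<in> {2..k} \<Longrightarrow> w (rung j) = 0" using step[of "j - 1"] by simp
qed

text \<open>The rotation by \<open>k\<close> fixes \<open>rung 1\<close> and carries the first half
  of the rim to the second.\<close>

lemma balanced_at_rung:
  assumes bal: "balanced_at V E (rung 1) w" and f: "f \<in> E" "f \<noteq> rung 1"
  shows "w f = 0"
proof -
  interpret T: moebius_ladder k "\<lambda>i. \<psi> (i + k)" V E by (rule rotate)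
  have T_rim: "T.rim i = rim (i + k)" for i
    by (auto simp: T.rim_def rim_def algebra_simps)
  have T_rung: "T.rung i = rung i" for i
    using rung_shift[of i] by (auto simp: T.rung_def rung_def algebra_simps)
  consider i where "f = rim i" | i where "f = rung i" using f(1) unfolding E_eq by blast
  then show ?thesis
  proof cases
    case 1
    then obtain j where j: "j \<in> {1..2 * k}" "f = rim j" using rim_cases by metis
    show ?thesis
    proof (cases "j \<le> k")
      case True
      then show ?thesis using j balanced_at_rung_rims(1)[OF bal] by simp
    next
      case False
      then show ?thesis using j T.balanced_at_rung_rims(1)[of w "j - k"] bal
        by (simp add: T_rim T_rung)
    qed
  next
    case 2
    then obtain j where j: "j \<in> {1..k}" "f = rung j" using rung_cases by metis
    with f(2) have "j \<noteq> 1" by auto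
    then show ?thesis using j balanced_at_rung_rims(2)[OF bal] by simp
  qed
qed

section \<open>Weights balanced at a rim edge\<close>

text \<open>Extension and opposite moves, each with its mirror image, clear every rim edge except
  \<open>rim 0\<close> and its two neighbours on the rim; for those neighbours the corner moves are
  needed.\<close>

lemma balanced_at_rim:
  assumes bal: "balanced_at V E (rim 0) w" and f: "f \<in> E" "f \<noteq> rim 0"
  shows "w f = 0"
proof -
  \<comment> \<open>This reflection exchanges \<open>0\<close> and \<open>1\<close>, the ends of
    \<open>rim 0\<close>. Labels are then brought back to positive representatives, and the end
    \<open>0\<close> appears as \<open>2 * k\<close>.\<close>
  interpret R: moebius_ladder k "\<lambda>i. \<psi> (1 - i)" V E by (rule reflect)
  have R_rim: "R.rim i = rim (2 * k - i)" for i
  proof -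
    have "R.rim i = rim (- i)" by (auto simp: R.rim_def rim_def algebra_simps)
    also have "\<dots> = rim (2 * k - i)" by (rule rim_cong) simp
    finally show ?thesis .
  qed
  have R_rung: "R.rung i = rung (k + 1 - i)" for i
  proof -
    have "R.rung i = rung (1 - k - i)" by (auto simp: R.rung_def rung_def algebra_simps)
    also have "\<dots> = rung (k + 1 - i)"
      using rung_cong[of "1 - k - i" "k + 1 - i"] by simp
    finally show ?thesis .
  qed
  have "\<psi> (2 * k) = \<psi> 0" "\<psi> (1 - 2 * k) = \<psi> 1" by (simp_all add: \<psi>_eq_iff)
  then have e: "{\<psi> 1, \<psi> (2 * k)} = rim 0" and eR: "{\<psi> (1 - 1), \<psi> (1 - 2 * k)} = rim 0"
    by (auto simp: rim_def)
  have ext: "w (rim b) = w (rim (b + 1)) + w (rung (b + 1))" if "1 \<le> b" "b < k" for b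
    by (rule balanced_at_extend_interval[of "2 * k"], unfold e) (use bal rim_in_E that in auto)
  have ext_R: "w (rim (k + j)) = w (rim (k + j - 1)) + w (rung j)" if "1 \<le> j" "j < k" for j
  proof -
    have "w (R.rim (k - j)) = w (R.rim (k - j + 1)) + w (R.rung (k - j + 1))"
      by (rule R.balanced_at_extend_interval[of "2 * k"], unfold eR) (use bal rim_in_E that in auto)
    then show ?thesis by (simp add: R_rim R_rung algebra_simps)
  qed
  have opp: "w (rim (k + j - 1)) + w (rim (k + j)) = w (rung j)" if "1 \<le> j" "j < k" for j
    by (rule balanced_at_add_opposite[of "2 * k"], unfold e) (use bal rim_in_E that in auto)
  have opp_R: "w (rim (b + 1)) + w (rim b) = w (rung (b + 1))" if "1 \<le> b" "b < k" for b
  proof -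
    have "w (R.rim (k + (k - b) - 1)) + w (R.rim (k + (k - b))) = w (R.rung (k - b))"
      by (rule R.balanced_at_add_opposite[of "2 * k"], unfold eR) (use bal rim_in_E that in auto)
    then show ?thesis by (simp add: R_rim R_rung algebra_simps)
  qed
  have corner: "w (rim 2) = w (rim 1) + w (rung 2)"
    by (rule balanced_at_add_corner, unfold e) (use bal rim_in_E in auto)
  have corner_R: "w (rim (2 * k - 2)) = w (rim (2 * k - 1)) + w (rung (k - 1))"
  proof -
    have "w (R.rim 2) = w (R.rim 1) + w (R.rung 2)"
      by (rule R.balanced_at_add_corner, unfold eR) (use bal rim_in_E in auto)
    then show ?thesis by (simp add: R_rim R_rung algebra_simps)
  qed
  \<comment> \<open>Substituting the rung weight from \<open>opp_R\<close> into \<open>ext\<close>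
    cancels \<open>rim (j - 1)\<close> and leaves twice the weight of \<open>rim j\<close>;
    \<open>high\<close> is the mirror image.\<close>
  have low: "w (rim j) = 0" if j: "2 \<le> j" "j \<le> k" for j
    using ext[of "j - 1"] opp_R[of "j - 1"] j by simp
  have high: "w (rim (k + j)) = 0" if j: "0 \<le> j" "j \<le> k - 2" for j
    using ext_R[of "j + 1"] opp[of "j + 1"] j by (simp add: algebra_simps)
  \<comment> \<open>With \<open>rim 2\<close> already zero, \<open>rim 1\<close> has both the weight
    of \<open>rung 2\<close> and its negative.\<close>
  have rim1: "w (rim 1) = 0" using ext[of 1] corner low[of 2] k by simp
  have "w (rim (2 * k - 2)) = 0" using high[of "k - 2"] k by simp
  then have rim_last: "w (rim (2 * k - 1)) = 0"
    using ext_R[of "k - 1"] corner_R k by (simp add: algebra_simps)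
  have rims: "w (rim j) = 0" if j: "1 \<le> j" "j < 2 * k" for j
  proof -
    consider "j = 1" | "2 \<le> j" "j \<le> k" | "k \<le> j" "j \<le> 2 * k - 2" | "j = 2 * k - 1"
      using j by linarith
    then show ?thesis using rim1 rim_last low[of j] high[of "j - k"] by cases auto
  qed
  consider i where "f = rim i" | i where "f = rung i" using f(1) unfolding E_eq by blast
  then show ?thesis
  proof cases
    case 1
    then obtain j where j: "j \<in> {1..2 * k}" "f = rim j" using rim_cases by metis
    have "rim (2 * k) = rim 0" by (rule rim_cong) simp
    with f(2) j have "j \<noteq> 2 * k" by auto
    then show ?thesis using j rims by simp
  next
    case 2
    then obtain j where j: "j \<in> {1..k}" "f = rung j" using rung_cases by metis
    show ?thesis
    proof (cases "j = 1")
      case True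
      \<comment> \<open>\<open>ext\<close> reaches rungs only from label \<open>2\<close> on; the
        first rung comes from the opposite move.\<close>
      then show ?thesis using j opp[of 1] rims[of k] rims[of "k + 1"] k by simp
    next
      case False
      then show ?thesis using j ext[of "j - 1"] rims[of "j - 1"] rims[of j] k by simp
    qed
  qed
qed

section \<open>Arbitrary edges, and bonds through them\<close>

lemma balanced_at_imp_zero:
  assumes bal: "balanced_at V E e w" and e: "e \<in> E" and f: "f \<in> E" "f \<noteq> e"
  shows "w f = 0"
proof -
  consider i where "e = rim i" | i where "e = rung i" using e unfolding E_eq by blast
  then show ?thesis
  proof cases
    case 1
    interpret T: moebius_ladder k "\<lambda>j. \<psi> (j + i)" V E by (rule rotate)
    have "e = T.rim 0" unfolding 1 by (simp add: T.rim_def rim_def add.commute)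
    then show ?thesis using T.balanced_at_rim bal f by blast
  next
    case 2
    \<comment> \<open>The shift is \<open>i - 1\<close> because the rung case is normalised at label
      \<open>1\<close>, the rim case at label \<open>0\<close>.\<close>
    interpret T: moebius_ladder k "\<lambda>j. \<psi> (j + (i - 1))" V E by (rule rotate)
    have "e = T.rung 1" unfolding 2 by (simp add: T.rung_def rung_def add.commute)
    then show ?thesis using T.balanced_at_rung bal f by blast
  qed
qed

lemma empty_mem_bonds: "{} \<in> bonds V E"
proof -
  have "bond_side V E (\<psi> ` {1..0})" by (rule bond_side_interval) (use k in simp)
  then show ?thesis unfolding bonds_eq_cut_bond_side by (force simp: cut_def)
qed

text \<open>The star of one end of \<open>e\<close> is a bond, since a single vertex is an
  arc.\<close>

lemma ex_bond_containing:
  assumes "e \<in> E"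
  shows "\<exists>D\<in>bonds V E. e \<in> D"
proof -
  obtain i j where e: "e = {\<psi> (0 + i), \<psi> (j + i)}" and j: "1 \<le> j" "j \<le> k"
    using assms k unfolding E by (force simp: add.commute)
  interpret T: moebius_ladder k "\<lambda>l. \<psi> (l + (i - 1))" V E by (rule rotate)
  have neq: "\<psi> (0 + i) \<noteq> \<psi> (j + i)" by (rule \<psi>_near_neq) (use j in auto)
  have "bond_side V E ((\<lambda>l. \<psi> (l + (i - 1))) ` {1..1})" by (rule T.bond_side_interval) (use k in simp)
  then have "cut E {\<psi> i} \<in> bonds V E" by (simp add: bonds_eq_cut_bond_side)
  moreover have "e \<in> cut E {\<psi> i}"
    using assms neq unfolding e by (simp add: mem_cut_pair[OF neq[simplified]])
  ultimately show ?thesis by blast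
qed

end

section \<open>The Wagner graph as a ladder\<close>

text \<open>Integers are sent to their representatives in \<open>{1..n}\<close>; subtracting one
  before \<open>mod\<close> and adding it afterwards makes \<open>n\<close>, not \<open>0\<close>,
  represent the multiples of \<open>n\<close>.\<close>

lemma moebius_ladder_wagner:
  assumes "even n" "n \<ge> 6"
  shows "moebius_ladder (int n div 2) (\<lambda>i. nat ((i - 1) mod int n) + 1)
    (wagner_verts n) (wagner_edges n)"
proof -
  define \<psi> where "\<psi> i = nat ((i - 1) mod int n) + 1" for i
  have n: "2 * (int n div 2) = int n" using assms by auto
  have n2: "int (n div 2) = int n div 2" by (simp add: zdiv_int)
  have canon: "\<psi> (int i) = i" if "1 \<le> i" "i \<le> n" for i
    using that by (simp add: \<psi>_def)
  have periodic: "\<psi> (i + int n) = \<psi> i" for i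
    unfolding \<psi>_def by (metis add_diff_eq add.commute mod_add_self2)
  have eq_iff: "\<psi> i = \<psi> j \<longleftrightarrow> int n dvd i - j" for i j
  proof -
    have "\<psi> i = \<psi> j \<longleftrightarrow> (i - 1) mod int n = (j - 1) mod int n"
      using assms by (auto simp: \<psi>_def nat_eq_iff)
    then show ?thesis by (simp add: mod_eq_dvd_iff)
  qed
  have repr: "\<exists>m. 1 \<le> m \<and> m \<le> n \<and> int n dvd i - int m" for i
  proof (intro exI conjI)
    show "1 \<le> \<psi> i" by (simp add: \<psi>_def)
    have "nat ((i - 1) mod int n) < n" using assms by (simp add: nat_less_iff)
    then show "\<psi> i \<le> n" by (simp add: \<psi>_def)
    then show "int n dvd i - int (\<psi> i)"
      using canon[of "\<psi> i"] \<open>1 \<le> \<psi> i\<close> by (metis eq_iff)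
  qed
  have shift: "\<psi> (i + t) = \<psi> (j + t)" if "int n dvd i - j" for i j t
    using that by (simp add: eq_iff)
  have verts: "wagner_verts n = range \<psi>"
  proof (intro equalityI subsetI)
    fix v assume "v \<in> wagner_verts n"
    then show "v \<in> range \<psi>" using canon[of v] by (metis wagner_verts_def atLeastAtMost_iff rangeI)
  next
    fix v assume "v \<in> range \<psi>"
    then obtain i where "v = \<psi> i" by auto
    then show "v \<in> wagner_verts n" using repr[of i] canon eq_iff
      by (metis wagner_verts_def atLeastAtMost_iff)
  qed
  \<comment> \<open>This identifies the closing edge \<open>{n, 1}\<close> with the rim edge at
    \<open>n\<close>.\<close>
  have \<psi>n: "\<psi> (int n + 1) = 1" using canon[of 1] periodic[of 1] assms by (simp add: add.commute)
  have edges: "wagner_edges n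
      = range (\<lambda>i. {\<psi> i, \<psi> (i + 1)}) \<union> range (\<lambda>i. {\<psi> i, \<psi> (i + int n div 2)})" (is "_ = ?E")
  proof (intro equalityI subsetI)
    fix f assume "f \<in> wagner_edges n"
    then consider m where "f = {m, m + 1}" "1 \<le> m" "m < n" | "f = {n, 1}"
      | m where "f = {m, m + n div 2}" "1 \<le> m" "m \<le> n div 2"
      unfolding wagner_edges_def by blast
    then show "f \<in> ?E"
    proof cases
      case 1
      then have "f = {\<psi> (int m), \<psi> (int m + 1)}" using canon[of m] canon[of "m + 1"]
        by (simp add: add.commute)
      then show ?thesis by blast
    next
      case 2
      then have "f = {\<psi> (int n), \<psi> (int n + 1)}" using canon[of n] \<psi>n assms by simp
      then show ?thesis by blast
    next
      case 3
      then have "f = {\<psi> (int m), \<psi> (int m + int n div 2)}"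
        using canon[of m] canon[of "m + n div 2"] by (simp add: n2)
      then show ?thesis by blast
    qed
  next
    fix f assume "f \<in> ?E"
    then consider i where "f = {\<psi> i, \<psi> (i + 1)}" | i where "f = {\<psi> i, \<psi> (i + int n div 2)}"
      by blast
    then show "f \<in> wagner_edges n"
    proof cases
      case 1
      obtain m where m: "1 \<le> m" "m \<le> n" "int n dvd i - int m" using repr by blast
      have f: "f = {m, \<psi> (int m + 1)}"
        using 1 canon[OF m(1,2)] shift[OF m(3), of 0] shift[OF m(3), of 1] by simp
      show ?thesis
      proof (cases "m = n")
        case True
        then show ?thesis using f \<psi>n by (auto simp: wagner_edges_def)
      next
        case False
        then have "f = {m, m + 1}" using f m canon[of "m + 1"] by (simp add: add.commute)
        moreover have "m < n" using m(2) False by simp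
        ultimately show ?thesis using m(1) unfolding wagner_edges_def by blast
      qed
    next
      case 2
      obtain m where m: "1 \<le> m" "m \<le> n" "int n dvd i - int m" using repr by blast
      have f: "f = {m, \<psi> (int m + int n div 2)}"
        using 2 canon[OF m(1,2)] shift[OF m(3), of 0] shift[OF m(3), of "int n div 2"] by simp
      show ?thesis
      proof (cases "m \<le> n div 2")
        case True
        then have "f = {m, m + n div 2}" using f m canon[of "m + n div 2"] by (simp add: n2)
        then show ?thesis using m True unfolding wagner_edges_def by blast
      next
        case False
        \<comment> \<open>In the upper half, the rung at \<open>m\<close> is listed in
          \<open>wagner_edges\<close> under its other end \<open>l\<close>.\<close>
        define l where "l = m - n div 2"
        have l: "m = l + n div 2" "1 \<le> l" "l \<le> n div 2"
          using False m(2) assms(1) by (auto simp: l_def)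
        have "int m + int n div 2 = int l + int n" using l(1) n n2 by simp
        then have "\<psi> (int m + int n div 2) = l"
          using l(2,3) periodic[of "int l"] canon[of l] by simp
        then have "f = {l, l + n div 2}" unfolding f using l(1) by auto
        then show ?thesis using l unfolding wagner_edges_def by blast
      qed
    qed
  qed
  have "moebius_ladder (int n div 2) \<psi> (wagner_verts n) (wagner_edges n)"
    by unfold_locales (use assms n eq_iff verts edges in auto)
  then show ?thesis unfolding \<psi>_def .
qed

section \<open>From balanced weights to facets\<close>

lemma inner_incidence_vec:
  fixes edge :: "'e::finite \<Rightarrow> 'v set" and u :: "real ^ 'e"
  assumes bij: "bij_betw edge UNIV E" and D: "D \<subseteq> E"
  shows "u \<bullet> incidence_vec edge D = (\<Sum>f\<in>D. u $ inv edge f)"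
proof -
  have inj: "inj edge" and ran: "range edge = E" using bij by (auto simp: bij_betw_def)
  have img: "edge ` {i. edge i \<in> D} = D" using D ran by auto
  have "u \<bullet> incidence_vec edge D = (\<Sum>i\<in>UNIV. if edge i \<in> D then u $ i else 0)"
    unfolding inner_vec_def incidence_vec_def by (rule sum.cong) auto
  also have "\<dots> = (\<Sum>i | edge i \<in> D. u $ i)" by (simp add: sum.If_cases)
  also have "\<dots> = (\<Sum>f\<in>edge ` {i. edge i \<in> D}. u $ inv edge f)"
    using inj by (subst sum.reindex) (auto intro: inj_on_subset)
  finally show ?thesis unfolding img .
qed

text \<open>A vector orthogonal to all differences of points of the face, read as edge weights, is
  balanced at \<open>edge e\<close>. By \<open>zero\<close> it lives on coordinate \<open>e\<close>
  alone, so the directions of the face fill the hyperplane \<open>H\<close>.\<close>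

lemma facet_defining_axis_bond_polytope:
  fixes edge :: "'e::finite \<Rightarrow> 'v set" and e :: 'e
  assumes bij: "bij_betw edge UNIV E"
    and empty: "{} \<in> bonds V E"
    and ex: "\<exists>D\<in>bonds V E. edge e \<in> D"
    and zero: "\<And>w f. balanced_at V E (edge e) w \<Longrightarrow> f \<in> E \<Longrightarrow> f \<noteq> edge e \<Longrightarrow> w f = 0"
  shows "facet_defining (axis e 1) 1 (bond_polytope V E edge)"
proof -
  define P where "P = bond_polytope V E edge"
  define a :: "real ^ 'e" where "a = axis e 1"
  define F where "F = P \<inter> {x. a \<bullet> x = 1}"
  define H where "H = {x. a \<bullet> x = 0}"
  have inj: "inj edge" using bij by (simp add: bij_betw_def)
  have a_inner: "a \<bullet> x = x $ e" for x by (simp add: a_def inner_axis')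
  have a0: "a \<noteq> 0" by (simp add: a_def)
  have bonds_sub: "D \<subseteq> E" if "D \<in> bonds V E" for D
    using that by (auto simp: bonds_def cut_def)
  have vec_P: "incidence_vec edge D \<in> P" if "D \<in> bonds V E" for D
    unfolding P_def bond_polytope_def using that by (intro hull_inc) auto
  have P_le: "a \<bullet> x \<le> 1" if "x \<in> P" for x
  proof -
    have "P \<subseteq> {x. a \<bullet> x \<le> 1}"
      unfolding P_def bond_polytope_def
      by (rule hull_minimal, force simp: a_inner incidence_vec_def, rule convex_halfspace_le)
    with that show ?thesis by auto
  qed
  have convP: "convex P" unfolding P_def bond_polytope_def by (rule convex_convex_hull)
  have face: "F face_of P"
    unfolding F_def by (rule face_of_Int_supporting_hyperplane_le[OF convP P_le])
  have vec_F: "incidence_vec edge D \<in> F" if "D \<in> bonds V E" "edge e \<in> D" for D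
    using that vec_P by (auto simp: F_def a_inner incidence_vec_def)
  obtain D0 where D0: "D0 \<in> bonds V E" "edge e \<in> D0" using ex by blast
  define x0 where "x0 = incidence_vec edge D0"
  have x0: "x0 \<in> F" unfolding x0_def by (rule vec_F[OF D0])
  define G where "G = (+) (- x0) ` F"
  have subH: "subspace H" unfolding H_def by (rule subspace_hyperplane)
  have "G \<subseteq> H" using x0 by (auto simp: G_def H_def F_def inner_diff_right)
  then have sp: "span G \<subseteq> H" using subH by (rule span_minimal)
  have "span G = H"
  proof (rule ccontr)
    assume "span G \<noteq> H"
    with sp have "span G \<subset> span H" using span_eq_iff subH by blast
    then obtain u where u: "u \<noteq> 0" "u \<in> span H" and orth: "\<And>y. y \<in> span G \<Longrightarrow> orthogonal u y"
      using orthogonal_to_subspace_exists_gen by blast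
    have "sum (\<lambda>f. u $ inv edge f) D = u \<bullet> x0" if D: "D \<in> bonds V E" "edge e \<in> D" for D
    proof -
      have "- x0 + incidence_vec edge D \<in> span G"
        using vec_F[OF D] by (intro span_base) (auto simp: G_def)
      from orth[OF this] have "u \<bullet> incidence_vec edge D = u \<bullet> x0"
        by (simp add: orthogonal_def inner_diff_right)
      then show ?thesis using inner_incidence_vec[OF bij bonds_sub[OF D(1)]] by metis
    qed
    then have "balanced_at V E (edge e) (\<lambda>f. u $ inv edge f)"
      unfolding balanced_at_def by blast
    note z = zero[OF this]
    have "u $ i = 0" for i
    proof (cases "i = e")
      \<comment> \<open>Coordinate \<open>e\<close>, about which \<open>zero\<close> says nothing,
        vanishes because \<open>u\<close> was chosen inside \<open>H\<close>.\<close>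
      case True
      have "u \<in> H" using u(2) subH by (metis span_eq_iff)
      then show ?thesis using True by (simp add: H_def a_inner)
    next
      case False
      then have "edge i \<noteq> edge e" using inj by (auto dest: injD)
      then show ?thesis using z[of "edge i"] bij inj by (auto simp: bij_betw_def)
    qed
    then show False using u(1) by (simp add: vec_eq_iff)
  qed
  moreover have "aff_dim F = int (dim G)"
    unfolding G_def by (rule aff_dim_eq_dim) (rule hull_inc[OF x0])
  moreover have "dim H = DIM(real ^ 'e) - 1"
    unfolding H_def by (rule dim_hyperplane[OF a0])
  ultimately have dimF: "aff_dim F = int (DIM(real ^ 'e) - 1)" by (metis dim_span)
  \<comment> \<open>The empty cut lies off the face, so \<open>P\<close> has larger dimension than
    \<open>F\<close>; as \<open>F\<close> is already one below the whole space, \<open>P\<close> is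
    full-dimensional and \<open>F\<close> has codimension one in it.\<close>
  have "incidence_vec edge {} \<in> P - F"
    using vec_P[OF empty] by (auto simp: F_def a_inner incidence_vec_def)
  then have "aff_dim F < aff_dim P"
    by (intro face_of_aff_dim_lt[OF convP face]) auto
  moreover have "aff_dim P \<le> int DIM(real ^ 'e)" by (rule aff_dim_le_DIM)
  ultimately have "aff_dim F = aff_dim P - 1" using dimF by linarith
  then have "F facet_of P" using face x0 unfolding facet_of_def by blast
  then show ?thesis
    unfolding facet_defining_def using P_le by (simp add: F_def P_def a_def)
qed

(* axis e 1 is the unit vector of coordinate e, so the inequality is x $ e \<le> 1 *)
theorem theorem7p6:
  fixes n :: nat and edge :: "'e::finite \<Rightarrow> nat set" and e :: 'e
  assumes "even n" and "n \<ge> 6"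
    and "bij_betw edge UNIV (wagner_edges n)"
  shows "facet_defining (axis e 1) 1 (bond_polytope (wagner_verts n) (wagner_edges n) edge)"
proof -
  interpret moebius_ladder "int n div 2" "\<lambda>i. nat ((i - 1) mod int n) + 1"
      "wagner_verts n" "wagner_edges n"
    by (rule moebius_ladder_wagner[OF assms(1,2)])
  have e: "edge e \<in> wagner_edges n" using assms(3) by (auto simp: bij_betw_def)
  show ?thesis
    by (rule facet_defining_axis_bond_polytope[OF assms(3) empty_mem_bonds ex_bond_containing[OF e]])
      (use balanced_at_imp_zero[OF _ e] in blast)
qed

end
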